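(* Let $n\ge 1$, $\alpha\in\mathbb{Z}_{\ge1}^n$ with $d:=\sum_{j=1}^n\alpha_j\ge2$, and $f(x)=x^\alpha=\prod_{j=1}^n x_j^{\alpha_j}$. Then $$\mu\big(\operatorname{conv}\mathcal{G}_{[0,1]^n}(f)\big)=\Big(1-\frac1d\Big)d^{\frac1{1-d}}.$$
   Context: For a set $X\subseteq\mathbb{R}^n\times\mathbb{R}$, $\mu(X):=\max_{(x,w)\in X}|w-x^\alpha|$. The graph is $\mathcal{G}_{[0,1]^n}(f)=\{(x,w)\in[0,1]^n\times\mathbb{R}\mid w=x^\alpha\}$, and $\operatorname{conv}$ denotes the convex hull. *)

theory Defs
  imports "HOL-Analysis.Analysis"
begin

definition monomial :: "nat ^ 'n::finite \<Rightarrow> real ^ 'n \<Rightarrow> real" where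
  "monomial \<alpha> x = (\<Prod>j\<in>UNIV. (x $ j) ^ (\<alpha> $ j))"

definition graph_on :: "'a set \<Rightarrow> ('a \<Rightarrow> real) \<Rightarrow> ('a \<times> real) set" where
  "graph_on D f = {(x, w). x \<in> D \<and> w = f x}"

definition deviations :: "nat ^ 'n::finite \<Rightarrow> ((real ^ 'n) \<times> real) set \<Rightarrow> real set" where
  "deviations \<alpha> X = {\<bar>w - monomial \<alpha> x\<bar> | x w. (x, w) \<in> X}"

definition has_greatest :: "real set \<Rightarrow> bool" where
  "has_greatest S \<longleftrightarrow> (\<exists>m\<in>S. \<forall>v\<in>S. v \<le> m)"

(* A genuine maximum, not a supremum: the value is unspecified unless
   has_greatest (deviations \<alpha> X). Statements about \<mu> should assert that as well. *)
definition \<mu> :: "nat ^ 'n::finite \<Rightarrow> ((real ^ 'n) \<times> real) set \<Rightarrow> real" where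
  "\<mu> \<alpha> X = (GREATEST v. v \<in> deviations \<alpha> X)"

end

theory Submission
  imports Defs
begin

text \<open>
  On the cube, \<open>f x = x\<^sup>\<alpha>\<close> lies above \<open>0\<close> and \<open>1 - (\<Sum>j. \<alpha>\<^sub>j * (1 - x\<^sub>j))\<close> and below every \<open>x\<^sub>j\<close>.
  These bounds are affine, so they pass to the convex hull of the graph. Above the graph,
  with \<open>m\<close> the least coordinate of \<open>x\<close>, they give \<open>w - f x \<le> m - m^d\<close>, whose maximum, at
  \<open>T = d powr (1 / (1 - d))\<close>, is the claimed value. Below the graph, with \<open>s = (\<Sum>j. \<alpha>\<^sub>j * x\<^sub>j) / d\<close>,
  AM-GM gives \<open>f x - w \<le> s^d - max 0 (1 - d * (1 - s)) \<le> (1 - 1/d)^d\<close>, and Bernoulli's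
  inequality shows that this does not exceed \<open>T - T^d\<close>. Equality holds at the point of the
  segment from \<open>(0, 0)\<close> to \<open>(1, 1)\<close> all of whose coordinates are \<open>T\<close>.
\<close>

text \<open>Bernoulli's inequality for \<open>t / s\<close>, scaled by \<open>s ^ n\<close>. The
  tangent at \<open>T\<close> controls the gap above the graph, a tangent at a variable point the
  gap below it.\<close>

lemma power_ge_tangent:
  fixes s t :: real
  assumes "0 \<le> s" "0 \<le> t"
  shows "s ^ n + real n * s ^ (n - 1) * (t - s) \<le> t ^ n"
proof (cases "s = 0 \<or> n = 0")
  case True
  \<comment> \<open>For \<open>s = 0\<close> and \<open>n = 1\<close>, the convention
    \<open>0 ^ 0 = 1\<close> makes the left side equal to \<open>t\<close>; for \<open>s = 0\<close>
    and \<open>n > 1\<close> the left side vanishes.\<close>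
  then show ?thesis
    using assms by (cases "n \<le> 1") (auto simp: le_Suc_eq power_0_left)
next
  case False
  then have s: "s > 0" and n: "n > 0" using assms by auto
  have "1 + real n * (t / s - 1) \<le> (1 + (t / s - 1)) ^ n"
    using assms s by (intro Bernoulli_inequality) simp
  then have "s ^ n * (1 + real n * (t / s - 1)) \<le> s ^ n * (t / s) ^ n"
    using s by (intro mult_left_mono) auto
  also have "s ^ n * (t / s) ^ n = t ^ n"
    using s by (simp add: power_divide)
  also have "s ^ n * (1 + real n * (t / s - 1)) = s ^ n + real n * s ^ (n - 1) * (t - s)"
    using s n by (cases n) (auto simp: field_simps)
  finally show ?thesis .
qed

text \<open>Bernoulli's inequality bounds each \<open>1 - x j ^ k j\<close> by
  \<open>k j * (1 - x j)\<close>; the Weierstrass product inequality combines the factors.\<close>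

lemma sum_one_minus_le_prod_power:
  fixes x :: "'a \<Rightarrow> real"
  assumes "\<And>j. j \<in> A \<Longrightarrow> 0 \<le> x j" "\<And>j. j \<in> A \<Longrightarrow> x j \<le> 1"
  shows "1 - (\<Sum>j\<in>A. real (k j) * (1 - x j)) \<le> (\<Prod>j\<in>A. x j ^ k j)"
proof -
  have "(\<Sum>j\<in>A. 1 - x j ^ k j) \<le> (\<Sum>j\<in>A. real (k j) * (1 - x j))"
  proof (rule sum_mono)
    fix j assume "j \<in> A"
    then have "1 + real (k j) * (x j - 1) \<le> (1 + (x j - 1)) ^ k j"
      using assms by (intro Bernoulli_inequality) auto
    then show "1 - x j ^ k j \<le> real (k j) * (1 - x j)"
      by (simp add: algebra_simps)
  qed
  moreover have "1 - (\<Sum>j\<in>A. 1 - x j ^ k j) \<le> (\<Prod>j\<in>A. 1 - (1 - x j ^ k j))"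
    using assms by (intro Weierstrass_prod_ineq) (auto intro: power_le_one)
  ultimately show ?thesis by simp
qed

text \<open>Polya's argument: with \<open>s\<close> the weighted mean, apply
  \<open>y \<le> exp (y - 1)\<close> to \<open>y = x j / s\<close>; in the product the exponents sum
  to \<open>0\<close>. The division by \<open>s\<close> makes \<open>s = 0\<close> a separate case,
  where some factor is \<open>0\<close>.\<close>

lemma weighted_arith_geo_mean:
  fixes x :: "'a \<Rightarrow> real"
  assumes "finite A" "\<And>j. j \<in> A \<Longrightarrow> 0 \<le> x j" "(\<Sum>j\<in>A. k j) = d" "d > 0"
  shows "(\<Prod>j\<in>A. x j ^ k j) \<le> ((\<Sum>j\<in>A. real (k j) * x j) / real d) ^ d"
proof -
  define s where "s = (\<Sum>j\<in>A. real (k j) * x j) / real d"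
  have s0: "s \<ge> 0"
    unfolding s_def using assms by (intro divide_nonneg_nonneg sum_nonneg) auto
  have sum: "(\<Sum>j\<in>A. real (k j) * x j) = real d * s"
    using assms by (simp add: s_def)
  show ?thesis
  proof (cases "s = 0")
    case True
    have "\<exists>j\<in>A. k j \<noteq> 0"
      using assms by (metis less_irrefl sum.neutral)
    then obtain j where j: "j \<in> A" "k j \<noteq> 0" by blast
    have "real (k j) * x j = 0"
      using sum True j assms sum_nonneg_eq_0_iff[of A "\<lambda>j. real (k j) * x j"] by auto
    then have "(\<Prod>j\<in>A. x j ^ k j) = 0"
      using j assms by (auto intro!: bexI[of _ j])
    then show ?thesis
      using s0 by (simp add: s_def)
  next
    case False
    with s0 have s: "s > 0" by simp
    have "(\<Prod>j\<in>A. x j ^ k j) \<le> (\<Prod>j\<in>A. (s * exp (x j / s - 1)) ^ k j)"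
    proof (intro prod_mono conjI power_mono)
      fix j assume "j \<in> A"
      show "x j \<le> s * exp (x j / s - 1)"
        using exp_ge_add_one_self[of "x j / s - 1"] s by (simp add: field_simps)
    qed (use assms in auto)
    also have "\<dots> = (\<Prod>j\<in>A. s ^ k j) * (\<Prod>j\<in>A. exp (real (k j) * (x j / s - 1)))"
      by (simp add: power_mult_distrib prod.distrib exp_of_nat_mult)
    also have "\<dots> = s ^ d * exp (\<Sum>j\<in>A. real (k j) * (x j / s - 1))"
      using assms by (simp add: exp_sum flip: power_sum)
    also have "(\<Sum>j\<in>A. real (k j) * (x j / s - 1)) = (\<Sum>j\<in>A. real (k j) * x j) / s - real (\<Sum>j\<in>A. k j)"
      by (simp add: sum_subtractf sum_divide_distrib algebra_simps)
    also have "\<dots> = 0"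
      using sum s assms by simp
    finally show ?thesis
      by (simp add: s_def)
  qed
qed

lemma monomial_hull_bounds:
  fixes \<alpha> :: "nat ^ 'n::finite"
  assumes "\<forall>j. \<alpha> $ j \<ge> 1"
    and "(x, w) \<in> convex hull (graph_on (cbox 0 1) (monomial \<alpha>))"
  shows "0 \<le> w" "1 - (\<Sum>j\<in>UNIV. real (\<alpha> $ j) * (1 - x $ j)) \<le> w" "w \<le> x $ j" "x $ j \<le> 1"
proof -
  let ?S = "{(x, w). 0 \<le> w \<and> 1 - (\<Sum>j\<in>UNIV. real (\<alpha> $ j) * (1 - x $ j)) \<le> w
    \<and> (\<forall>j. w \<le> x $ j \<and> x $ j \<le> 1)} :: ((real ^ 'n) \<times> real) set"
  have "convex ?S"
  proof (rule convexI, clarsimp, intro conjI allI)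
    fix x y :: "real ^ 'n" and v w a b :: real
    assume ab: "0 \<le> a" "0 \<le> b" "a + b = 1" "0 \<le> v" "0 \<le> w"
      and v: "1 - (\<Sum>j\<in>UNIV. real (\<alpha> $ j) * (1 - x $ j)) \<le> v"
      and w: "1 - (\<Sum>j\<in>UNIV. real (\<alpha> $ j) * (1 - y $ j)) \<le> w"
      and x: "\<forall>j. v \<le> x $ j \<and> x $ j \<le> 1" and y: "\<forall>j. w \<le> y $ j \<and> y $ j \<le> 1"
    \<comment> \<open>Writing \<open>1\<close> as \<open>a + b\<close> lets the affine bound split
      along the convex combination.\<close>
    have "1 - (\<Sum>j\<in>UNIV. real (\<alpha> $ j) * (1 - (a * x $ j + b * y $ j)))
       = (a + b) - (\<Sum>j\<in>UNIV. real (\<alpha> $ j) * ((a + b) - (a * x $ j + b * y $ j)))"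
      using ab by simp
    also have "\<dots> = a * (1 - (\<Sum>j\<in>UNIV. real (\<alpha> $ j) * (1 - x $ j)))
        + b * (1 - (\<Sum>j\<in>UNIV. real (\<alpha> $ j) * (1 - y $ j)))"
      by (simp add: algebra_simps sum.distrib sum_subtractf sum_distrib_left)
    also have "\<dots> \<le> a * v + b * w"
      using ab v w by (intro add_mono mult_left_mono) auto
    finally show "1 - (\<Sum>j\<in>UNIV. real (\<alpha> $ j) * (1 - (a * x $ j + b * y $ j))) \<le> a * v + b * w" .
    fix j
    show "a * v + b * w \<le> a * x $ j + b * y $ j"
      using ab x y by (intro add_mono mult_left_mono) auto
    show "a * x $ j + b * y $ j \<le> 1"
      using ab x y by (intro convex_bound_le) auto
  qed
  moreover have "graph_on (cbox 0 1) (monomial \<alpha>) \<subseteq> ?S"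
  proof (clarsimp simp: graph_on_def mem_box_cart, intro conjI allI)
    fix x :: "real ^ 'n"
    assume x: "\<forall>j. 0 \<le> x $ j \<and> x $ j \<le> 1"
    show "0 \<le> monomial \<alpha> x"
      unfolding monomial_def using x by (intro prod_nonneg) auto
    show "1 - (\<Sum>j\<in>UNIV. real (\<alpha> $ j) * (1 - x $ j)) \<le> monomial \<alpha> x"
      unfolding monomial_def using x by (intro sum_one_minus_le_prod_power) auto
    fix j
    \<comment> \<open>The other factors are at most \<open>1\<close>, and
      \<open>x $ j ^ (\<alpha> $ j) \<le> x $ j\<close> since the exponent is at least
      \<open>1\<close>.\<close>
    have "monomial \<alpha> x = x $ j ^ (\<alpha> $ j) * (\<Prod>i\<in>UNIV - {j}. x $ i ^ (\<alpha> $ i))"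
      unfolding monomial_def by (simp add: prod.remove)
    also have "\<dots> \<le> x $ j ^ (\<alpha> $ j) * 1"
      using x by (intro mult_left_mono prod_le_1) (auto intro: power_le_one)
    also have "\<dots> \<le> x $ j ^ 1 * 1"
      using x assms(1) by (intro mult_right_mono power_decreasing) auto
    finally show "monomial \<alpha> x \<le> x $ j" by simp
  qed
  ultimately have "(x, w) \<in> ?S"
    using assms(2) hull_minimal[of _ ?S convex] by blast
  then show "0 \<le> w" "1 - (\<Sum>j\<in>UNIV. real (\<alpha> $ j) * (1 - x $ j)) \<le> w" "w \<le> x $ j" "x $ j \<le> 1"
    by auto
qed

theorem corollary1p1:
  fixes \<alpha> :: "nat ^ 'n::finite" and d :: nat
  assumes "\<forall>j. \<alpha> $ j \<ge> 1"
    and "d = (\<Sum>j\<in>UNIV. \<alpha> $ j)"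
    and "d \<ge> 2"
  shows "has_greatest (deviations \<alpha> (convex hull (graph_on (cbox 0 1) (monomial \<alpha>))))
    \<and> \<mu> \<alpha> (convex hull (graph_on (cbox 0 1) (monomial \<alpha>)))
        = (1 - 1 / real d) * real d powr (1 / (1 - real d))"
proof -
  let ?G = "graph_on (cbox 0 1) (monomial \<alpha>)"
  \<comment> \<open>The critical point of \<open>t - t ^ d\<close>, that is, the solution of
    \<open>d * T ^ (d - 1) = 1\<close>.\<close>
  define T where "T = real d powr (1 / (1 - real d))"
  define C where "C = (1 - 1 / real d) * T"
  have T0: "T > 0"
    using assms(3) by (simp add: T_def)
  have Td1: "T ^ (d - 1) = 1 / real d"
  proof -
    have "T ^ (d - 1) = real d powr (real (d - 1) * (1 / (1 - real d)))"
      using assms(3) by (simp add: T_def powr_power)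
    also have "real (d - 1) * (1 / (1 - real d)) = -1"
      using assms(3) by (simp add: of_nat_diff field_simps)
    finally show ?thesis
      using assms(3) by (simp add: powr_minus_divide)
  qed
  have T1: "T \<le> 1"
    using assms(3) powr_mono[of "1 / (1 - real d)" 0 "real d"] by (simp add: T_def)
  have C_eq: "C = T - T ^ d"
  proof -
    have "T ^ d = T * T ^ (d - 1)"
      using assms(3) by (cases d) auto
    then show ?thesis
      unfolding Td1 by (simp add: C_def algebra_simps)
  qed
  \<comment> \<open>The tangent to \<open>t ^ d\<close> at \<open>T\<close> has slope
    \<open>1\<close>, so \<open>T ^ d + (t - T) \<le> t ^ d\<close>.\<close>
  have over: "t - t ^ d \<le> C" if "0 \<le> t" for t
    using power_ge_tangent[of T t d] T0 that assms(3) unfolding Td1 C_eq by simp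
  \<comment> \<open>Cancelling one factor \<open>?q\<close> leaves
    \<open>?q ^ (d - 1) \<le> T\<close>. Raised to the power \<open>d - 1\<close> and inverted, this
    reads \<open>d \<le> (1 + 1 / (d - 1)) ^ ((d - 1) * (d - 1))\<close>, which is Bernoulli's
    inequality.\<close>
  have under_const: "(1 - 1 / real d) ^ d \<le> C"
  proof -
    let ?q = "1 - 1 / real d"
    have q0: "?q > 0" using assms(3) by (simp add: field_simps)
    have inv: "1 / ?q = 1 + 1 / real (d - 1)"
      using assms(3) by (simp add: of_nat_diff field_simps)
    have "real d = 1 + real ((d - 1) * (d - 1)) * (1 / real (d - 1))"
      using assms(3) by (simp add: of_nat_diff)
    also have "\<dots> \<le> (1 + 1 / real (d - 1)) ^ ((d - 1) * (d - 1))"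
      by (rule Bernoulli_inequality, rule order.trans[of _ 0]) auto
    also have "\<dots> = 1 / (?q ^ (d - 1)) ^ (d - 1)"
      unfolding inv[symmetric] by (simp add: power_one_over power_mult)
    finally have "1 / (1 / (?q ^ (d - 1)) ^ (d - 1)) \<le> 1 / real d"
      using assms(3) by (intro divide_left_mono) auto
    then have "(?q ^ (d - 1)) ^ (d - 1) \<le> T ^ (d - 1)"
      unfolding Td1 by simp
    then have "?q ^ (d - 1) \<le> T"
      using T0 q0 assms(3) by (subst (asm) power_mono_iff) auto
    then have "?q * ?q ^ (d - 1) \<le> ?q * T"
      using q0 by (intro mult_left_mono) auto
    then show ?thesis
      using assms(3) by (cases d) (auto simp: C_def)
  qed
  have bound: "\<bar>w - monomial \<alpha> x\<bar> \<le> C" if xw: "(x, w) \<in> convex hull ?G" for x w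
  proof -
    note h = monomial_hull_bounds[OF assms(1) xw]
    have x0: "0 \<le> x $ j" for j
      using h(1) h(3)[of j] by linarith
    define m where "m = Min (range (($) x))"
    have m: "m \<in> range (($) x)" and m_le: "m \<le> x $ j" for j
      by (auto simp: m_def)
    have m0: "0 \<le> m" and wm: "w \<le> m"
      using m h(3) x0 by auto
    have "m ^ d = (\<Prod>j\<in>UNIV. m ^ (\<alpha> $ j))"
      by (simp add: assms(2) power_sum)
    also have "\<dots> \<le> monomial \<alpha> x"
      unfolding monomial_def using m0 m_le by (intro prod_mono conjI power_mono) auto
    finally have A: "w - monomial \<alpha> x \<le> C"
      using over[OF m0] wm by linarith
    define s where "s = (\<Sum>j\<in>UNIV. real (\<alpha> $ j) * x $ j) / real d"
    have sum: "(\<Sum>j\<in>UNIV. real (\<alpha> $ j) * x $ j) = real d * s"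
      using assms(3) by (simp add: s_def)
    have s0: "0 \<le> s"
      unfolding s_def using x0 by (intro divide_nonneg_nonneg sum_nonneg) auto
    have "(\<Sum>j\<in>UNIV. real (\<alpha> $ j) * x $ j) \<le> (\<Sum>j\<in>UNIV. real (\<alpha> $ j) * 1)"
      using h(4) by (intro sum_mono mult_left_mono) auto
    then have s1: "s \<le> 1"
      using assms(3) unfolding sum by (simp add: assms(2)[symmetric] flip: of_nat_sum)
    have "(\<Sum>j\<in>UNIV. real (\<alpha> $ j) * (1 - x $ j)) = real d - real d * s"
      using sum by (simp add: assms(2) right_diff_distrib sum_subtractf)
    then have w: "1 - real d + real d * s \<le> w"
      using h(2) by linarith
    have "monomial \<alpha> x \<le> s ^ d"
      unfolding monomial_def s_def using x0 assms by (intro weighted_arith_geo_mean) auto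
    moreover have "s ^ d - w \<le> (1 - 1 / real d) ^ d"
    \<comment> \<open>The two lower bounds \<open>0\<close> and \<open>1 - d * (1 - s)\<close> for
      \<open>w\<close> cross at \<open>s = 1 - 1 / d\<close>.\<close>
    proof (cases "s \<le> 1 - 1 / real d")
      case True
      then have "s ^ d \<le> (1 - 1 / real d) ^ d"
        using s0 by (intro power_mono)
      then show ?thesis
        using h(1) by linarith
    next
      case False
      let ?q = "1 - 1 / real d"
      \<comment> \<open>The tangent at \<open>s\<close> is evaluated at \<open>?q\<close>. As
        \<open>?q - s\<close> is negative and \<open>s ^ (d - 1) \<le> 1\<close>, its slope may be
        replaced by \<open>d\<close>, the slope of the lower bound for \<open>w\<close>.\<close>
      have "s ^ d + s ^ (d - 1) * (real d * (?q - s)) \<le> ?q ^ d"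
        using power_ge_tangent[of s ?q d] s0 assms(3) by (simp add: mult_ac)
      moreover have "s ^ (d - 1) * (real d * (?q - s)) \<ge> 1 * (real d * (?q - s))"
        using False s0 s1 by (intro mult_right_mono_neg power_le_one mult_nonneg_nonpos) auto
      moreover have "real d * (?q - s) = real d - 1 - real d * s"
        using assms(3) by (simp add: field_simps)
      ultimately show ?thesis
        using w by linarith
    qed
    ultimately show ?thesis
      using A under_const by linarith
  qed
  let ?D = "deviations \<alpha> (convex hull ?G)"
  have "C \<in> ?D"
  proof -
    have "(0, 0) \<in> ?G"
      using assms(1) by (auto simp: graph_on_def mem_box_cart monomial_def Suc_le_eq power_0_left)
    moreover have "(1, 1) \<in> ?G"
      by (simp add: graph_on_def mem_box_cart monomial_def)
    ultimately have "(1 - T) *\<^sub>R (0, 0) + T *\<^sub>R (1, 1) \<in> convex hull ?G"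
      using T0 T1 by (intro convexD convex_convex_hull hull_inc) auto
    moreover have "monomial \<alpha> (T *\<^sub>R 1) = T ^ d"
      by (simp add: monomial_def assms(2) power_sum)
    \<comment> \<open>The bound \<open>over\<close> at \<open>t = 0\<close> says
      \<open>0 \<le> C\<close>, which removes the absolute value.\<close>
    moreover have "C = \<bar>T - T ^ d\<bar>"
      using C_eq over[of 0] assms(3) by (simp add: power_0_left)
    ultimately show ?thesis
      unfolding deviations_def by (intro CollectI exI[of _ "T *\<^sub>R 1"] exI[of _ T]) simp
  qed
  moreover have "v \<le> C" if "v \<in> ?D" for v
    using that bound by (auto simp: deviations_def)
  ultimately show ?thesis
    unfolding has_greatest_def \<mu>_def C_def T_def by (blast intro: Greatest_equality)
qed

end
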